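(* Suppose that $\lambda$ and $\mu$ are partitions of $n$ with at most two parts, and that $N(\lambda)$ and $N(\mu)$ commute over a field $K$. Assume that the largest part of $\lambda$ is at least as large as the largest part of $\mu$. Then one of the following holds. (i) $\lambda=\mu$. (ii) $n=2m$, $\lambda=(n)$ and $\mu=(m,m)$. (iii) $n=2m$, $\lambda=(m+1,m-1)$, $\mu=(m,m)$ and, if $K$ is finite, then the exponent of $\mathrm{PGL}_2(K)$ does not divide $m$. (iv) $n=2m+1$, $\lambda=(n)$ and $\mu=(m+1,m)$.
   Context: A partition of $n$ is a weakly decreasing finite sequence of positive integers (its parts) with sum $n$. For a partition $\lambda$ of $n$ and a field $K$, $N(\lambda)$ denotes the similarity class of nilpotent matrices in $\mathrm{Mat}_n(K)$ whose Jordan block sizes are the parts of $\lambda$. $N(\lambda)$ and $N(\mu)$ commute over $K$ if there exist commuting matrices $X\in N(\lambda)$ and $Y\in N(\mu)$ with entries in $K$. The exponent of a finite group is the least positive integer $e$ such that $g^e=1$ for all elements $g$. *)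

theory Defs
  imports "Jordan_Normal_Form.Jordan_Normal_Form" "HOL-Algebra.Coset"
begin

definition is_partition :: "nat list \<Rightarrow> nat \<Rightarrow> bool" where
  "is_partition lam n \<longleftrightarrow> sorted_wrt (\<ge>) lam \<and> (\<forall>k\<in>set lam. 0 < k) \<and> sum_list lam = n"

text \<open>The class \<open>N(\<lambda>)\<close>; the field \<open>K\<close> is the entry type, and the size of the matrices is the
  number partitioned by \<open>\<lambda>\<close>.\<close>

definition nilpotent_class :: "nat list \<Rightarrow> 'a::field mat set" where
  "nilpotent_class lam =
     {A \<in> carrier_mat (sum_list lam) (sum_list lam). jordan_nf A (map (\<lambda>k. (k, 0)) lam)}"

definition nilpotent_classes_commute :: "'a::field itself \<Rightarrow> nat list \<Rightarrow> nat list \<Rightarrow> bool" where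
  "nilpotent_classes_commute K lam mu \<longleftrightarrow>
     (\<exists>X \<in> (nilpotent_class lam :: 'a mat set). \<exists>Y \<in> nilpotent_class mu. X * Y = Y * X)"

definition GL :: "nat \<Rightarrow> 'a::field itself \<Rightarrow> 'a mat monoid" where
  "GL d K = units_of (ring_mat K d ())"

definition nonzero_scalar_mats :: "nat \<Rightarrow> 'a::field itself \<Rightarrow> 'a mat set" where
  "nonzero_scalar_mats d K = {c \<cdot>\<^sub>m 1\<^sub>m d | c. c \<noteq> 0}"

definition PGL :: "nat \<Rightarrow> 'a::field itself \<Rightarrow> 'a mat set monoid" where
  "PGL d K = GL d K Mod nonzero_scalar_mats d K"

text \<open>Meaningful only for groups of finite exponent, in particular for finite groups.\<close>

definition group_exponent :: "('g, 'h) monoid_scheme \<Rightarrow> nat" where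
  "group_exponent G = (LEAST e. 0 < e \<and> (\<forall>g\<in>carrier G. g [^]\<^bsub>G\<^esub> e = \<one>\<^bsub>G\<^esub>))"

lemma group_GL: "group (GL d K)" for K :: "'a::field itself"
proof -
  have "ring_mat K d () = ring_mat TYPE('a) d ()"
    by (simp add: ring_mat_def)
  then interpret semiring "ring_mat K d ()"
    using semiring_mat[of d "()"] by metis
  show ?thesis unfolding GL_def by (rule units_group)
qed

lemma carrier_GL:
  "carrier (GL d K) = {A \<in> carrier_mat d d. \<exists>B \<in> carrier_mat d d. B * A = 1\<^sub>m d \<and> A * B = 1\<^sub>m d}"
  by (auto simp: GL_def units_of_def Units_def ring_mat_simps)

lemma normal_nonzero_scalar_mats: "nonzero_scalar_mats d K \<lhd> GL d K"
  for K :: "'a::field itself"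
proof -
  interpret G: group "GL d K" by (rule group_GL)
  have m: "mult (GL d K) = (*)" and o: "one (GL d K) = 1\<^sub>m d"
    by (auto simp: GL_def units_of_def ring_mat_simps)
  have prod: "(c \<cdot>\<^sub>m 1\<^sub>m d) * (e \<cdot>\<^sub>m 1\<^sub>m d) = (c * e) \<cdot>\<^sub>m (1\<^sub>m d :: 'a mat)" for c e :: 'a
    by (intro eq_matI) auto
  have one: "1 \<cdot>\<^sub>m 1\<^sub>m d = (1\<^sub>m d :: 'a mat)"
    by (intro eq_matI) auto
  have car: "c \<cdot>\<^sub>m 1\<^sub>m d \<in> carrier (GL d K)" if "c \<noteq> 0" for c :: 'a
    unfolding carrier_GL using that
    by (auto intro!: bexI[of _ "inverse c \<cdot>\<^sub>m 1\<^sub>m d"] simp: prod one)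
  have central: "A * (c \<cdot>\<^sub>m 1\<^sub>m d) = (c \<cdot>\<^sub>m 1\<^sub>m d) * A" if "A \<in> carrier_mat d d" for A and c :: 'a
    using that by (simp add: mult_smult_distrib[of _ d d _ d] mult_smult_assoc_mat[of _ d d _ d])
  have inv: "inv\<^bsub>GL d K\<^esub> (c \<cdot>\<^sub>m 1\<^sub>m d) = inverse c \<cdot>\<^sub>m 1\<^sub>m d" if "c \<noteq> 0" for c :: 'a
  proof (rule G.inv_equality)
    show "(inverse c \<cdot>\<^sub>m 1\<^sub>m d) \<otimes>\<^bsub>GL d K\<^esub> (c \<cdot>\<^sub>m 1\<^sub>m d) = \<one>\<^bsub>GL d K\<^esub>"
      using that by (simp add: m o prod one)
  qed (use that in \<open>auto intro: car\<close>)
  have sub: "subgroup (nonzero_scalar_mats d K) (GL d K)"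
  proof
    show "nonzero_scalar_mats d K \<subseteq> carrier (GL d K)"
      by (auto simp: nonzero_scalar_mats_def intro: car)
    show "\<one>\<^bsub>GL d K\<^esub> \<in> nonzero_scalar_mats d K"
      by (auto simp: nonzero_scalar_mats_def o one intro!: exI[of _ 1])
    show "x \<otimes>\<^bsub>GL d K\<^esub> y \<in> nonzero_scalar_mats d K"
      if "x \<in> nonzero_scalar_mats d K" "y \<in> nonzero_scalar_mats d K" for x y
      using that by (force simp: nonzero_scalar_mats_def m prod)
    show "inv\<^bsub>GL d K\<^esub> x \<in> nonzero_scalar_mats d K" if "x \<in> nonzero_scalar_mats d K" for x
      using that by (force simp: nonzero_scalar_mats_def inv)
  qed
  show ?thesis
  proof (rule G.normalI[OF sub], intro ballI)
    fix A assume "A \<in> carrier (GL d K)"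
    hence A: "A \<in> carrier_mat d d" by (simp add: carrier_GL)
    show "nonzero_scalar_mats d K #>\<^bsub>GL d K\<^esub> A = A <#\<^bsub>GL d K\<^esub> nonzero_scalar_mats d K"
      using central[OF A] by (auto simp: r_coset_def l_coset_def m nonzero_scalar_mats_def)
  qed
qed

lemma group_PGL: "group (PGL d K)"
  unfolding PGL_def by (rule normal.factorgroup_is_group[OF normal_nonzero_scalar_mats])

end

theory Submission
  imports Defs "HOL-Library.Function_Algebras" "HOL-Algebra.Multiplicative_Group"
begin

text \<open>
  Let \<open>X\<close> and \<open>Y\<close> be commuting nilpotent maps of types \<open>\<lambda>\<close> and \<open>\<mu>\<close> on \<open>V = K\<^sup>n\<close>. If \<open>\<lambda> = (n)\<close>, then
  \<open>Y\<close> is a polynomial in \<open>X\<close>, and if \<open>\<mu>\<close> has two parts then \<open>Y V = X\<^sup>2 V\<close>, which gives (ii) and (iv).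

  Now let both have two parts, so that \<open>X V\<close> and \<open>Y V\<close> have codimension 2. If they coincide, then
  \<open>X\<^sup>k V = Y\<^sup>k V\<close> for all \<open>k\<close> and \<open>\<lambda> = \<mu>\<close>. Otherwise \<open>M = X V + Y V\<close> has codimension 1, say
  \<open>V = K e + M\<close>, and \<open>X M = Y M\<close>; hence \<open>X\<^sup>k M = Y\<^sup>k M\<close> for all \<open>k\<close>, so the nilpotency indices \<open>a\<close> of
  \<open>X\<close> and \<open>c\<close> of \<open>Y\<close> satisfy \<open>a \<le> c + 1\<close>. If \<open>Y\<close> to the power \<open>c - 1\<close> has rank one, its
  image is killed by \<open>X\<close>, so it vanishes on \<open>M\<close> and \<open>a \<le> c\<close>. Thus \<open>c < a\<close> forces
  \<open>\<mu> = (m, m)\<close> and \<open>\<lambda> = (m + 1, m - 1)\<close>. Moreover \<open>Y\<^sup>2 e\<close> is congruent to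
  \<open>\<alpha> X\<^sup>2 e + \<beta> X Y e\<close> modulo \<open>X\<^sup>2 M\<close>, where one can take \<open>\<alpha> \<noteq> 0\<close>. Therefore the powers of the
  companion matrix \<open>C\<close> of \<open>t\<^sup>2 - \<beta> t - \<alpha>\<close> compute \<open>Y\<^sup>k e\<close> modulo \<open>X\<^sup>k M\<close>. If the exponent of
  \<open>PGL\<^sub>2(K)\<close> divided \<open>m\<close>, then \<open>C\<^sup>m\<close> would be a nonzero scalar \<open>c\<close> and
  \<open>0 = Y\<^sup>m e = c X\<^sup>m e\<close>, contradicting \<open>X\<^sup>m \<noteq> 0\<close> and \<open>X\<^sup>m M = 0\<close>.
\<close>

subsection \<open>Commuting nilpotent maps\<close>

locale scalar_space = vector_space scale
  for scale :: "'k::field \<Rightarrow> 'v::ab_group_add \<Rightarrow> 'v" (infixr "*s" 75)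
begin

text \<open>Dimension of \<open>V / U\<close> at most 2 (and at least 2 in the next definition),
  phrased by linear relations modulo \<open>U\<close> so that no quotient or basis enters.\<close>

definition codim_le2 :: "'v set \<Rightarrow> 'v set \<Rightarrow> bool" where
  "codim_le2 V U \<longleftrightarrow> (\<forall>x\<in>V. \<forall>y\<in>V. \<forall>z\<in>V. \<exists>r s t.
     (r \<noteq> 0 \<or> s \<noteq> 0 \<or> t \<noteq> 0) \<and> r *s x + s *s y + t *s z \<in> U)"

definition codim_ge2 :: "'v set \<Rightarrow> 'v set \<Rightarrow> bool" where
  "codim_ge2 V U \<longleftrightarrow> (\<exists>x\<in>V. \<exists>y\<in>V. \<forall>r s. r *s x + s *s y \<in> U \<longrightarrow> r = 0 \<and> s = 0)"

lemma subspace_scale_cancel: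
  assumes "subspace U" "c *s x \<in> U" "c \<noteq> 0"
  shows "x \<in> U"
  using subspace_scale[OF assms(1,2), of "inverse c"] assms(3) by simp

lemma subspace_add_cancel:
  assumes "subspace U" "x + y \<in> U" "x \<in> U"
  shows "y \<in> U"
  using subspace_diff[OF assms] by simp

text \<open>Given \<open>x\<close> and \<open>y\<close> independent modulo \<open>W\<close>, a
  relation among \<open>x\<close>, \<open>y\<close>, \<open>w\<close> modulo \<open>U\<close>
  reduces to \<open>t *s w \<in> U\<close> with \<open>t \<noteq> 0\<close>. This dimension count
  turns inclusions into equalities.\<close>

lemma codim2_antimono:
  assumes U: "subspace U" and W: "subspace W" "W \<subseteq> V" and UW: "U \<subseteq> W"
    and le: "codim_le2 V U" and ge: "codim_ge2 V W"
  shows "W \<subseteq> U"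
proof
  fix w assume w: "w \<in> W"
  obtain x y where xy: "x \<in> V" "y \<in> V"
    and ind: "\<And>r s. r *s x + s *s y \<in> W \<Longrightarrow> r = 0 \<and> s = 0"
    using ge unfolding codim_ge2_def by blast
  obtain r s t where nz: "r \<noteq> 0 \<or> s \<noteq> 0 \<or> t \<noteq> 0" and mem: "r *s x + s *s y + t *s w \<in> U"
    using le xy w W(2) unfolding codim_le2_def by blast
  have "t *s w + (r *s x + s *s y) \<in> W"
    using mem UW by (auto simp: ac_simps)
  hence "r *s x + s *s y \<in> W"
    by (rule subspace_add_cancel[OF W(1)]) (rule subspace_scale[OF W(1) w])
  hence rs: "r = 0" "s = 0" using ind by auto
  with mem have "t *s w \<in> U" by simp
  thus "w \<in> U" by (rule subspace_scale_cancel[OF U]) (use nz rs in auto)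
qed

end

locale commuting_pair = scalar_space scale
  for scale :: "'k::field \<Rightarrow> 'v::ab_group_add \<Rightarrow> 'v" (infixr "*s" 75) +
  fixes V :: "'v set" and X Y :: "'v \<Rightarrow> 'v"
  assumes subspace_V: "subspace V"
    and X_add: "X (u + v) = X u + X v" and X_scale: "X (c *s v) = c *s X v"
    and Y_add: "Y (u + v) = Y u + Y v" and Y_scale: "Y (c *s v) = c *s Y v"
    and X_V: "v \<in> V \<Longrightarrow> X v \<in> V" and Y_V: "v \<in> V \<Longrightarrow> Y v \<in> V"
    and comm: "X (Y v) = Y (X v)"
    and X_nilp: "\<exists>N. \<forall>v\<in>V. (X ^^ N) v = 0" and Y_nilp: "\<exists>N. \<forall>v\<in>V. (Y ^^ N) v = 0"
begin

lemma swap: "commuting_pair scale V Y X"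
  by unfold_locales
    (use subspace_V X_add X_scale Y_add Y_scale X_V Y_V comm X_nilp Y_nilp in auto)

lemma X_0: "X 0 = 0"
  using X_scale[of 0 0] by simp

lemma X_diff: "X (u - v) = X u - X v"
  using X_add[of "u - v" v] by (simp add: algebra_simps)

lemma X_pow_add: "(X ^^ k) (u + v) = (X ^^ k) u + (X ^^ k) v"
  by (induction k) (auto simp: X_add)

lemma X_pow_scale: "(X ^^ k) (c *s v) = c *s (X ^^ k) v"
  by (induction k) (auto simp: X_scale)

lemma X_pow_0: "(X ^^ k) 0 = 0"
  by (induction k) (auto simp: X_0)

lemma X_pow_V: "v \<in> V \<Longrightarrow> (X ^^ k) v \<in> V"
  by (induction k) (auto simp: X_V)

lemma Y_X_pow: "Y ((X ^^ k) v) = (X ^^ k) (Y v)"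
  by (induction k) (auto simp: comm[symmetric])

lemma subspace_image_X: "subspace S \<Longrightarrow> subspace (X ` S)"
  unfolding subspace_def
  by (auto simp: image_iff) (metis X_0, metis X_add, metis X_scale)

lemmas Y_0 = commuting_pair.X_0[OF swap]
  and Y_diff = commuting_pair.X_diff[OF swap]
  and Y_pow_add = commuting_pair.X_pow_add[OF swap]
  and Y_pow_V = commuting_pair.X_pow_V[OF swap]
  and X_Y_pow = commuting_pair.Y_X_pow[OF swap]
  and subspace_image_Y = commuting_pair.subspace_image_X[OF swap]

text \<open>Iterating S \<subseteq> U + X S gives S \<subseteq> U + X^k S, and X^k vanishes on
  \<open>V\<close> for large \<open>k\<close>. The set \<open>S\<close> may be an image or a single
  line.\<close>

lemma nakayama_X:
  assumes U: "subspace U" and XU: "\<And>u. u \<in> U \<Longrightarrow> X u \<in> U"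
    and S: "S \<subseteq> V" and step: "\<And>s. s \<in> S \<Longrightarrow> \<exists>u\<in>U. \<exists>s'\<in>S. s = u + X s'"
  shows "S \<subseteq> U"
proof
  fix s assume s: "s \<in> S"
  have "\<exists>u\<in>U. \<exists>s'\<in>S. s = u + (X ^^ k) s'" for k
  proof (induction k)
    case 0
    show ?case using s subspace_0[OF U] by force
  next
    case (Suc k)
    then obtain u s' where us: "u \<in> U" "s' \<in> S" "s = u + (X ^^ k) s'" by blast
    obtain u' s'' where us': "u' \<in> U" "s'' \<in> S" "s' = u' + X s''"
      using step[OF us(2)] by blast
    have "(X ^^ k) u' \<in> U" using us'(1) XU by (induction k) auto
    moreover have "s = (u + (X ^^ k) u') + (X ^^ Suc k) s''"
      using us us' by (simp add: X_pow_add funpow_swap1 add.assoc)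
    ultimately show ?case using us us' subspace_add[OF U] by metis
  qed
  moreover obtain N where "\<forall>v\<in>V. (X ^^ N) v = 0" using X_nilp by blast
  ultimately show "s \<in> U" using S by (metis add.right_neutral subsetD)
qed

lemmas nakayama_Y = commuting_pair.nakayama_X[OF swap]

definition M :: "'v set" where
  "M = {X v + Y w | v w. v \<in> V \<and> w \<in> V}"

lemma M_swap: "commuting_pair.M V Y X = M"
  unfolding M_def commuting_pair.M_def[OF swap] by (metis add.commute)

lemma subspace_M: "subspace M"
  using subspace_sums[OF subspace_image_X[OF subspace_V] subspace_image_Y[OF subspace_V]]
  unfolding M_def by (smt (verit) Collect_cong image_iff)

lemma M_V: "m \<in> M \<Longrightarrow> m \<in> V"
  unfolding M_def using X_V Y_V subspace_add[OF subspace_V] by blast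

lemma XV_M: "v \<in> V \<Longrightarrow> X v \<in> M"
  unfolding M_def using subspace_0[OF subspace_V] Y_0 by force

lemma YV_M: "v \<in> V \<Longrightarrow> Y v \<in> M"
  unfolding M_def using subspace_0[OF subspace_V] X_0 by force

lemma XV_eq_V:
  assumes "V \<subseteq> X ` V"
  shows "V \<subseteq> {0}"
proof (rule nakayama_X)
  show "subspace {0}" by (simp add: subspace_def)
  show "\<exists>u\<in>{0}. \<exists>s'\<in>V. s = u + X s'" if "s \<in> V" for s using that assms by auto
qed (use X_0 in auto)

text \<open>V = X V + Y V would give V = X V by Nakayama for \<open>Y\<close>, and then V = 0 by
  Nakayama for \<open>X\<close>.\<close>

lemma M_proper:
  assumes "V \<noteq> {0}"
  shows "\<exists>e\<in>V. e \<notin> M"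
proof (rule ccontr)
  assume "\<not> ?thesis"
  hence VM: "V \<subseteq> M" by blast
  have "V \<subseteq> X ` V"
  proof (rule nakayama_Y)
    show "subspace (X ` V)" by (rule subspace_image_X[OF subspace_V])
    show "Y u \<in> X ` V" if "u \<in> X ` V" for u using that Y_V by (auto simp: comm[symmetric])
    show "\<exists>u\<in>X ` V. \<exists>s'\<in>V. s = u + Y s'" if "s \<in> V" for s
      using that VM unfolding M_def by blast
  qed auto
  hence "V \<subseteq> {0}" by (rule XV_eq_V)
  thus False using assms subspace_0[OF subspace_V] by auto
qed

text \<open>By commutation X^(k+1) S = X^k Y S = Y X^k S, and induction applies.\<close>

lemma X_pow_image_eq:
  assumes eq: "X ` S = Y ` S"
  shows "(X ^^ k) ` S = (Y ^^ k) ` S"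
proof (induction k)
  case (Suc k)
  have "(X ^^ Suc k) ` S = (X ^^ k) ` (Y ` S)"
    by (simp only: funpow_Suc_right image_comp[symmetric] eq)
  also have "\<dots> = Y ` (X ^^ k) ` S"
    by (auto simp: image_iff Y_X_pow)
  finally show ?case using Suc by (simp add: image_comp)
qed simp

text \<open>Here \<open>V = K[X] e\<close>, so \<open>Y\<close> acts as \<open>X\<^sup>k\<close> times a unit of \<open>K[X]\<close>, and the corank of \<open>Y\<close>
  forces \<open>k = 2\<close>.\<close>

lemma cyclic_case:
  assumes e: "e \<in> V" and V: "\<And>v. v \<in> V \<Longrightarrow> \<exists>r. \<exists>w\<in>V. v = r *s e + X w"
    and le: "codim_le2 V (Y ` V)" and ge: "codim_ge2 V (Y ` V)"
  shows "Y ` V = (X ^^ 2) ` V"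
proof -
  have sX: "subspace (X ` V)" and sY: "subspace (Y ` V)"
    by (rule subspace_image_X[OF subspace_V], rule subspace_image_Y[OF subspace_V])
  have sX2: "subspace ((X ^^ 2) ` V)"
    using subspace_image_X[OF sX] by (simp add: numeral_2_eq_2 image_comp comp_def)
  \<comment> \<open>V = K f + Y V would make the codimension of Y V at most one.\<close>
  have not_one: "\<not> (\<forall>v\<in>V. \<exists>r. \<exists>w\<in>V. v = r *s f + Y w)" if f: "f \<in> V" for f
  proof
    assume one: "\<forall>v\<in>V. \<exists>r. \<exists>w\<in>V. v = r *s f + Y w"
    obtain x y where xy: "x \<in> V" "y \<in> V"
      and ind: "\<And>r s. r *s x + s *s y \<in> Y ` V \<Longrightarrow> r = 0 \<and> s = 0"
      using ge unfolding codim_ge2_def by blast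
    obtain a v b w where x: "v \<in> V" "x = a *s f + Y v" and y: "w \<in> V" "y = b *s f + Y w"
      using one xy by meson
    have "b *s x + (- a) *s y = Y (b *s v + (- a) *s w)"
      by (simp add: x y Y_add Y_diff Y_scale scale_right_distrib mult.commute scale_right_diff_distrib)
    hence "b *s x + (- a) *s y \<in> Y ` V"
      using x y by (auto intro!: imageI subspace_diff subspace_V subspace_scale)
    from ind[OF this] have "a = 0" by simp
    hence "1 *s x + 0 *s y \<in> Y ` V" using x by auto
    from ind[OF this] show False by simp
  qed
  have "V \<noteq> {0}"
    using not_one[of 0] subspace_0[OF subspace_V] Y_0 by force
  then obtain f where f: "f \<in> V" "f \<notin> M" using M_proper by blast
  \<comment> \<open>Eliminating \<open>e\<close> between \<open>Y v\<close> and a vector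
    \<open>f\<close> outside \<open>M\<close> leaves an element of X V, so the coefficient of
    \<open>e\<close> in \<open>Y v\<close> must vanish.\<close>
  have YX: "Y v \<in> X ` V" if v: "v \<in> V" for v
  proof -
    obtain r w where r: "w \<in> V" "f = r *s e + X w" using V f by blast
    obtain s z where s: "z \<in> V" "Y v = s *s e + X z" using V Y_V v by blast
    have "r *s Y v + (- s) *s f = X (r *s z + (- s) *s w)"
      by (simp add: r s X_add X_diff X_scale scale_right_distrib mult.commute scale_right_diff_distrib)
    hence 1: "r *s Y v + (- s) *s f \<in> X ` V"
      using r s by (auto intro!: imageI subspace_diff subspace_V subspace_scale)
    hence "r *s Y v + (- s) *s f \<in> M" using XV_M by auto
    hence "(- s) *s f \<in> M"
      by (rule subspace_add_cancel[OF subspace_M]) (intro subspace_scale subspace_M YV_M v)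
    hence "s = 0" using subspace_scale_cancel[OF subspace_M, of "- s" f] f by auto
    thus ?thesis using s by auto
  qed
  have "Y e \<in> (X ^^ 2) ` V"
  proof (rule ccontr)
    assume neg: "Y e \<notin> (X ^^ 2) ` V"
    obtain v where v: "v \<in> V" "Y e = X v" using YX e by blast
    obtain s w where s: "w \<in> V" "v = s *s e + X w" using V v by blast
    have Ye: "Y e = s *s X e + X (X w)" using v s by (simp add: X_add X_scale)
    have s0: "s \<noteq> 0" using neg Ye s by (auto simp: numeral_2_eq_2 image_iff)
    \<comment> \<open>Since \<open>s \<noteq> 0\<close>, the relation expresses \<open>X e\<close>
      by \<open>Y e\<close> modulo X^2 V, so X V \<subseteq> Y V + X (X V) and Nakayama
      applies.\<close>
    have "X ` V \<subseteq> Y ` V"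
    proof (rule nakayama_X)
      show "X u \<in> Y ` V" if "u \<in> Y ` V" for u using that X_V by (auto simp: comm)
      show "\<exists>u\<in>Y ` V. \<exists>s'\<in>X ` V. x = u + X s'" if "x \<in> X ` V" for x
      proof -
        obtain r z where rz: "z \<in> V" "x = X (r *s e + X z)" using V \<open>x \<in> X ` V\<close> by blast
        have "x = Y ((r / s) *s e) + X (X (z - (r / s) *s w))"
          using s0 by (simp add: rz X_add X_diff X_scale Y_scale Ye scale_right_distrib)
        moreover have "(r / s) *s e \<in> V" "z - (r / s) *s w \<in> V"
          using e rz s by (auto intro!: subspace_diff subspace_V subspace_scale)
        ultimately show ?thesis by blast
      qed
    qed (use sY X_V in auto)
    hence "\<forall>v\<in>V. \<exists>r. \<exists>w\<in>V. v = r *s e + Y w" using V by (metis image_subset_iff imageE)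
    with not_one e show False by blast
  qed
  hence sub: "Y ` V \<subseteq> (X ^^ 2) ` V"
  proof -
    assume Ye: "Y e \<in> (X ^^ 2) ` V"
    have "Y v \<in> (X ^^ 2) ` V" if v: "v \<in> V" for v
    proof -
      obtain r w where r: "w \<in> V" "v = r *s e + X w" using V v by blast
      obtain z where z: "z \<in> V" "Y w = X z" using YX r by blast
      have "Y v = r *s Y e + (X ^^ 2) z"
        using r z by (simp add: Y_add Y_scale comm[symmetric] numeral_2_eq_2)
      thus ?thesis using Ye z by (auto intro!: subspace_add sX2 subspace_scale)
    qed
    thus ?thesis by blast
  qed
  \<comment> \<open>\<open>e\<close> and \<open>X e\<close> are independent modulo X^2 V, which
    upgrades the inclusion \<open>sub\<close> to an equality.\<close>
  have "codim_ge2 V ((X ^^ 2) ` V)"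
    unfolding codim_ge2_def
  proof (rule bexI[of _ e], rule bexI[of _ "X e"], intro allI impI)
    show "e \<in> V" "X e \<in> V" using e X_V by auto
    fix r s assume "r *s e + s *s X e \<in> (X ^^ 2) ` V"
    then obtain w where w: "w \<in> V" "s *s X e + r *s e = X (X w)"
      by (auto simp: numeral_2_eq_2 add.commute)
    have nX: "\<not> V \<subseteq> X ` V" using XV_eq_V \<open>V \<noteq> {0}\<close> subspace_0[OF subspace_V] by auto
    have eX: "e \<notin> X ` V"
    proof
      assume "e \<in> X ` V"
      hence "v \<in> X ` V" if "v \<in> V" for v
        using V[OF that] by (auto intro!: subspace_add sX subspace_scale)
      with nX show False by blast
    qed
    have "s *s X e + r *s e \<in> X ` V" using w X_V by auto
    hence "r *s e \<in> X ` V"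
      by (rule subspace_add_cancel[OF sX]) (use e in \<open>auto intro!: subspace_scale sX\<close>)
    hence r0: "r = 0" using eX subspace_scale_cancel[OF sX] by blast
    have "s = 0"
    proof (rule ccontr)
      assume s: "s \<noteq> 0"
      have "X e = inverse s *s (s *s X e)" using s by simp
      also have "s *s X e = X (X w)" using w r0 by simp
      finally have Xe: "X e = X (inverse s *s X w)" by (simp add: X_scale)
      \<comment> \<open>X e \<in> X (X V) gives X V \<subseteq> X (X V), so X V = 0 and
        \<open>V\<close> is the line spanned by \<open>e\<close>.\<close>
      have "X ` V \<subseteq> {0}"
      proof (rule nakayama_X)
        show "subspace {0}" by (simp add: subspace_def)
        show "\<exists>u\<in>{0}. \<exists>s'\<in>X ` V. x = u + X s'" if "x \<in> X ` V" for x
        proof -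
          obtain r z where rz: "z \<in> V" "x = X (r *s e + X z)" using V \<open>x \<in> X ` V\<close> by blast
          have "x = X (X (r *s inverse s *s w + z))" by (simp add: rz X_add X_scale Xe)
          moreover have "r *s inverse s *s w + z \<in> V" using w rz
            by (auto intro!: subspace_add subspace_V subspace_scale)
          ultimately show ?thesis by auto
        qed
      qed (use X_0 X_V in auto)
      hence "\<forall>v\<in>V. \<exists>r. \<exists>w\<in>V. v = r *s e + Y w"
        using V YX by (metis Y_0 image_subset_iff singletonD subspace_0 subspace_V)
      with not_one e show False by blast
    qed
    with r0 show "r = 0 \<and> s = 0" ..
  qed
  with sub show ?thesis
    using codim2_antimono[OF sY sX2 _ sub le] X_pow_V by blast
qed

end

lemma (in commuting_pair) commuting_pair_square: "commuting_pair scale V (X ^^ 2) Y"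
proof unfold_locales
  obtain N where N: "\<forall>v\<in>V. (X ^^ N) v = 0" using X_nilp by blast
  have "((X ^^ 2) ^^ N) v = (X ^^ N) ((X ^^ N) v)" for v
    by (simp only: funpow_mult mult_2 mult_2_right funpow_add comp_def)
  hence "((X ^^ 2) ^^ N) v = 0" if "v \<in> V" for v using N that X_pow_0 by simp
  thus "\<exists>N. \<forall>v\<in>V. ((X ^^ 2) ^^ N) v = 0" by blast
qed (use subspace_V X_pow_add X_pow_scale X_pow_V Y_add Y_scale Y_V Y_X_pow Y_nilp in auto)

text \<open>Y V = X^2 V implies Y^k V = X^(2k) V. This comparison of nilpotency indices will
  determine \<open>mu\<close> when \<open>lam = [n]\<close>.\<close>

lemma (in commuting_pair) cyclic_nilpotency:
  assumes "e \<in> V" "\<And>v. v \<in> V \<Longrightarrow> \<exists>r. \<exists>w\<in>V. v = r *s e + X w"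
    and "codim_le2 V (Y ` V)" "codim_ge2 V (Y ` V)"
  shows "(\<forall>v\<in>V. (Y ^^ k) v = 0) \<longleftrightarrow> (\<forall>v\<in>V. (X ^^ (2 * k)) v = 0)"
proof -
  have "((X ^^ 2) ^^ k) ` V = (Y ^^ k) ` V"
    using commuting_pair.X_pow_image_eq[OF commuting_pair_square] cyclic_case[OF assms] by simp
  hence "(X ^^ (2 * k)) ` V = (Y ^^ k) ` V" by (simp add: funpow_mult mult.commute)
  thus ?thesis by (metis (no_types, lifting) imageE imageI)
qed

section \<open>Two commuting maps of corank two with different images\<close>

locale corank2_pair = commuting_pair scale V X Y
  for scale :: "'k::field \<Rightarrow> 'v::ab_group_add \<Rightarrow> 'v" (infixr "*s" 75) and V X Y +
  assumes le_X: "codim_le2 V (X ` V)" and ge_X: "codim_ge2 V (X ` V)"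
    and le_Y: "codim_le2 V (Y ` V)" and ge_Y: "codim_ge2 V (Y ` V)"
    and neq: "X ` V \<noteq> Y ` V"
begin

lemma swap2: "corank2_pair scale V Y X"
  unfolding corank2_pair_def corank2_pair_axioms_def
  using swap le_X ge_X le_Y ge_Y neq by auto

lemma subspace_XV: "subspace (X ` V)" and subspace_YV: "subspace (Y ` V)"
  by (rule subspace_image_X[OF subspace_V], rule subspace_image_Y[OF subspace_V])

lemma not_YV_XV: "\<not> Y ` V \<subseteq> X ` V"
  using codim2_antimono[OF subspace_YV subspace_XV _ _ le_Y ge_X] neq X_V by blast

lemma not_XV_YV: "\<not> X ` V \<subseteq> Y ` V"
  by (rule corank2_pair.not_YV_XV[OF swap2])

lemma ex_generator: "\<exists>e\<in>V. e \<notin> M"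
proof (rule M_proper)
  show "V \<noteq> {0}" using not_YV_XV X_0 Y_0 by auto
qed

text \<open>\<open>e\<close> and any \<open>Y x\<close> outside X V span the plane V / X V, so
  \<open>M\<close> has codimension one.\<close>

lemma decompose:
  assumes e: "e \<in> V" "e \<notin> M" and v: "v \<in> V"
  shows "\<exists>r. \<exists>a\<in>V. \<exists>b\<in>V. v = r *s e + (X a + Y b)"
proof -
  obtain x where x: "x \<in> V" "Y x \<notin> X ` V" using not_YV_XV by blast
  obtain r s t where nz: "r \<noteq> 0 \<or> s \<noteq> 0 \<or> t \<noteq> 0"
    and mem: "r *s e + s *s Y x + t *s v \<in> X ` V"
    using le_X e(1) v Y_V[OF x(1)] unfolding codim_le2_def by blast
  have t: "t \<noteq> 0"
  proof
    assume t: "t = 0"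
    have "s *s Y x + r *s e \<in> M" using mem t XV_M by (auto simp: add.commute)
    hence "r *s e \<in> M"
      by (rule subspace_add_cancel[OF subspace_M]) (intro subspace_scale subspace_M YV_M x)
    hence r: "r = 0" using subspace_scale_cancel[OF subspace_M, of r e] e by auto
    hence "s *s Y x \<in> X ` V" using mem t by simp
    hence "s = 0" using subspace_scale_cancel[OF subspace_XV, of s "Y x"] x by auto
    with r t nz show False by simp
  qed
  obtain a where a: "a \<in> V" "r *s e + s *s Y x + t *s v = X a" using mem by blast
  have "t *s v = X a - r *s e - s *s Y x" using a(2) by (simp add: algebra_simps)
  hence "v = inverse t *s (X a - r *s e - s *s Y x)"
    using t by (metis left_inverse scale_one scale_scale)
  hence "v = (- (r / t)) *s e + (X (inverse t *s a) + Y ((- (s / t)) *s x))"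
    by (simp add: X_scale Y_scale scale_right_diff_distrib divide_inverse mult.commute
        del: scale_minus_left) (simp add: algebra_simps)
  moreover have "inverse t *s a \<in> V" "(- (s / t)) *s x \<in> V"
    using a x by (intro subspace_scale subspace_V; simp)+
  ultimately show ?thesis by blast
qed

text \<open>\<open>Y\<close> acts nilpotently on the plane V / X V, so its square is zero
  there.\<close>

lemma Y2_XV:
  assumes v: "v \<in> V"
  shows "Y (Y v) \<in> X ` V"
proof -
  obtain e where e: "e \<in> V" "e \<notin> M" using ex_generator by blast
  have Yu: "Y u \<in> X ` V" if "u \<in> X ` V" for u using that Y_V by (auto simp: comm[symmetric])
  have Ye: "Y e \<notin> X ` V"
  proof
    assume Ye: "Y e \<in> X ` V"
    have "Y ` V \<subseteq> X ` V"
    proof (rule nakayama_Y[OF subspace_XV Yu])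
      fix y assume "y \<in> Y ` V"
      then obtain x where x: "x \<in> V" "y = Y x" by blast
      obtain r a b where d: "a \<in> V" "b \<in> V" "x = r *s e + (X a + Y b)"
        using decompose[OF e x(1)] by blast
      have "y = (r *s Y e + X (Y a)) + Y (Y b)"
        by (simp add: x d Y_add Y_scale comm add.assoc)
      moreover have "r *s Y e + X (Y a) \<in> X ` V"
        using Ye d Y_V by (auto intro!: subspace_add subspace_scale subspace_XV)
      ultimately show "\<exists>u\<in>X ` V. \<exists>s'\<in>Y ` V. y = u + Y s'" using d by blast
    qed (use Y_V in auto)
    with not_YV_XV show False by simp
  qed
  obtain r s t where nz: "r \<noteq> 0 \<or> s \<noteq> 0 \<or> t \<noteq> 0"
    and mem: "r *s e + s *s Y e + t *s Y (Y e) \<in> X ` V"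
    using le_X e(1) Y_V unfolding codim_le2_def by blast
  have "(s *s Y e + t *s Y (Y e)) + r *s e \<in> M" using mem XV_M by (auto simp: ac_simps)
  hence "r *s e \<in> M"
    by (rule subspace_add_cancel[OF subspace_M])
      (intro subspace_add subspace_scale subspace_M YV_M e Y_V)
  hence r: "r = 0" using subspace_scale_cancel[OF subspace_M, of r e] e by auto
  have s: "s = 0"
  proof (rule ccontr)
    assume s: "s \<noteq> 0"
    \<comment> \<open>\<open>Y e\<close> would be a multiple of \<open>Y (Y e)\<close> modulo X V;
      Nakayama is applied to the line spanned by \<open>Y e\<close>.\<close>
    have "range (\<lambda>c. c *s Y e) \<subseteq> X ` V"
    proof (rule nakayama_Y[OF subspace_XV Yu])
      fix y assume "y \<in> range (\<lambda>c. c *s Y e)"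
      then obtain c where c: "y = c *s Y e" by blast
      have "y = (c / s) *s (s *s Y e + t *s Y (Y e)) + Y ((- (c / s * t)) *s Y e)"
        using s by (simp add: c Y_scale scale_right_distrib del: scale_minus_left) simp
      moreover have "(c / s) *s (s *s Y e + t *s Y (Y e)) \<in> X ` V"
        using mem r by (auto intro!: subspace_scale subspace_XV)
      ultimately show "\<exists>u\<in>X ` V. \<exists>s'\<in>range (\<lambda>c. c *s Y e). y = u + Y s'" by blast
    qed (use e Y_V in \<open>auto intro!: subspace_scale subspace_V\<close>)
    hence "1 *s Y e \<in> X ` V" by blast
    with Ye show False by simp
  qed
  have YYe: "Y (Y e) \<in> X ` V"
    using subspace_scale_cancel[OF subspace_XV, of t "Y (Y e)"] mem r s nz by auto
  have "(\<lambda>x. Y (Y x)) ` V \<subseteq> X ` V"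
  proof (rule nakayama_Y[OF subspace_XV Yu])
    fix y assume "y \<in> (\<lambda>x. Y (Y x)) ` V"
    then obtain x where x: "x \<in> V" "y = Y (Y x)" by blast
    obtain r a b where d: "a \<in> V" "b \<in> V" "x = r *s e + (X a + Y b)"
      using decompose[OF e x(1)] by blast
    have "y = (r *s Y (Y e) + X (Y (Y a))) + Y (Y (Y b))"
      by (simp add: x d Y_add Y_scale comm add.assoc)
    moreover have "r *s Y (Y e) + X (Y (Y a)) \<in> X ` V"
      using YYe d Y_V by (auto intro!: subspace_add subspace_scale subspace_XV)
    ultimately show "\<exists>u\<in>X ` V. \<exists>s'\<in>(\<lambda>x. Y (Y x)) ` V. y = u + Y s'" using d by blast
  qed (use Y_V in auto)
  thus ?thesis using v by blast
qed

lemma X2_YV: "v \<in> V \<Longrightarrow> X (X v) \<in> Y ` V"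
  by (rule corank2_pair.Y2_XV[OF swap2])

text \<open>Write \<open>Y (Y e) = X w\<close>. If \<open>w\<close> had a component along
  \<open>e\<close>, then X M \<subseteq> Y V would put \<open>X e\<close>, and with it all of X V,
  into Y V.\<close>

lemma Y2_XM:
  assumes v: "v \<in> V"
  shows "Y (Y v) \<in> X ` M"
proof -
  obtain e where e: "e \<in> V" "e \<notin> M" using ex_generator by blast
  have XM_YV: "X m \<in> Y ` V" if "m \<in> M" for m
    using that X2_YV X_V unfolding M_def
    by (auto simp: X_add comm intro!: subspace_add subspace_YV)
  have sXM: "subspace (X ` M)" by (rule subspace_image_X[OF subspace_M])
  have YYe: "Y (Y e) \<in> X ` M"
  proof -
    obtain w where w: "w \<in> V" "Y (Y e) = X w" using Y2_XV e by blast
    obtain r a b where d: "a \<in> V" "b \<in> V" "w = r *s e + (X a + Y b)"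
      using decompose[OF e w(1)] by blast
    have m: "X a + Y b \<in> M" using d unfolding M_def by blast
    have "r = 0"
    proof (rule ccontr)
      assume r: "r \<noteq> 0"
      have "X (X a + Y b) + r *s X e = Y (Y e)" by (simp add: w d X_add X_scale add.commute)
      hence "X (X a + Y b) + r *s X e \<in> Y ` V" using e Y_V by simp
      hence "r *s X e \<in> Y ` V" by (rule subspace_add_cancel[OF subspace_YV]) (rule XM_YV[OF m])
      hence Xe: "X e \<in> Y ` V" using subspace_scale_cancel[OF subspace_YV] r by blast
      have "X x \<in> Y ` V" if x: "x \<in> V" for x
      proof -
        obtain r a b where d: "a \<in> V" "b \<in> V" "x = r *s e + (X a + Y b)"
          using decompose[OF e x] by blast
        have "X a + Y b \<in> M" using d unfolding M_def by blast
        from XM_YV[OF this] show ?thesis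
          unfolding d(3) X_add[of "r *s e"] X_scale
          by (intro subspace_add subspace_scale subspace_YV Xe)
      qed
      with not_XV_YV show False by blast
    qed
    with w d m show ?thesis by simp
  qed
  obtain r a b where d: "a \<in> V" "b \<in> V" "v = r *s e + (X a + Y b)"
    using decompose[OF e v] by blast
  obtain w where w: "w \<in> V" "Y (Y b) = X w" using Y2_XV d by blast
  have "Y (Y v) = r *s Y (Y e) + (X (Y (Y a)) + X (Y w))"
    by (simp add: d Y_add Y_scale comm) (simp add: w comm)
  thus ?thesis
    using YYe YV_M d w Y_V by (auto intro!: subspace_add subspace_scale sXM)
qed

lemma YM_subset: "Y ` M \<subseteq> X ` M"
proof -
  have "Y (X a + Y b) \<in> X ` M" if "a \<in> V" "b \<in> V" for a b
    using that Y2_XM YV_M unfolding Y_add comm[symmetric]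
    by (intro subspace_add subspace_image_X subspace_M) auto
  thus ?thesis unfolding M_def by auto
qed

lemma XM_eq_YM: "X ` M = Y ` M"
  using YM_subset corank2_pair.YM_subset[OF swap2] by (simp add: M_swap)

lemma XM_YM_pow: "(X ^^ k) ` M = (Y ^^ k) ` M"
  by (rule X_pow_image_eq[OF XM_eq_YM])

lemma X_pow_M_eq_0:
  assumes "\<And>m. m \<in> M \<Longrightarrow> (Y ^^ k) m = 0" and "m \<in> M"
  shows "(X ^^ k) m = 0"
  using XM_YM_pow[of k] assms by (metis imageE imageI)

lemma X_pow_Suc_eq_0:
  assumes "\<And>m. m \<in> M \<Longrightarrow> (Y ^^ k) m = 0" and "v \<in> V"
  shows "(X ^^ Suc k) v = 0"
  using X_pow_M_eq_0[OF assms(1) XV_M[OF assms(2)]] by (simp add: funpow_swap1)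

lemma nilpotency_le_Suc:
  assumes "\<And>v. v \<in> V \<Longrightarrow> (Y ^^ c) v = 0" and "v \<in> V"
  shows "(X ^^ Suc c) v = 0"
  using assms M_V by (intro X_pow_Suc_eq_0) auto

text \<open>The image of Y^c is at most a line and is stable under the nilpotent map
  \<open>X\<close>, which therefore acts on it as zero. So Y^c kills X V, and it kills Y V because
  Y^(c+1) = 0; hence it kills \<open>M\<close>.\<close>

lemma nilpotency_le_of_rank_one:
  assumes Yc: "\<And>v. v \<in> V \<Longrightarrow> (Y ^^ Suc c) v = 0"
    and rank: "\<And>v. v \<in> V \<Longrightarrow> \<exists>r. (Y ^^ c) v = r *s z" and v: "v \<in> V"
  shows "(X ^^ Suc c) v = 0"
proof (rule X_pow_Suc_eq_0[OF _ v])
  have XY: "(Y ^^ c) (X w) = 0" if w: "w \<in> V" for w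
  proof -
    let ?y = "(Y ^^ c) w"
    obtain r r' where r: "?y = r *s z" "(Y ^^ c) (X w) = r' *s z" using rank w X_V by meson
    have Xy: "X ?y = r' *s z" using r(2) X_Y_pow by simp
    show ?thesis
    proof (cases "r = 0")
      case True
      with r show ?thesis using X_Y_pow X_0 by (metis scale_zero_left)
    next
      case False
      \<comment> \<open>\<open>t\<close> is the factor by which \<open>X\<close> acts on
        \<open>?y\<close>; nilpotency gives \<open>t ^ N *s ?y = 0\<close>, hence
        \<open>t = 0\<close> or \<open>?y = 0\<close>.\<close>
      define t where "t = r' / r"
      have Xy: "X ?y = t *s ?y" using False by (simp add: Xy t_def) (simp add: r)
      have pow: "(X ^^ k) ?y = t ^ k *s ?y" for k
        by (induction k) (simp_all add: X_scale Xy mult.commute)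
      obtain N where "\<forall>v\<in>V. (X ^^ N) v = 0" using X_nilp by blast
      hence "t ^ N *s ?y = 0" using pow Y_pow_V w by metis
      hence "t *s ?y = 0" by auto
      thus ?thesis using Xy X_Y_pow by metis
    qed
  qed
  fix m assume "m \<in> M"
  then obtain a b where "a \<in> V" "b \<in> V" "m = X a + Y b" unfolding M_def by blast
  thus "(Y ^^ c) m = 0" using XY Yc by (simp add: Y_pow_add funpow_swap1)
qed

text \<open>In \<open>Y (Y e) = X m\<close> with \<open>m = X a + Y b\<close>, the two coefficients
  are those of \<open>a\<close> and \<open>b\<close> along \<open>e\<close>; the rest is absorbed
  into X^2 M by Y M \<subseteq> X M.\<close>

lemma quadratic_relation_aux:
  assumes e: "e \<in> V" "e \<notin> M"
  shows "\<exists>\<alpha> \<beta>. \<exists>w\<in>M. Y (Y e) = \<alpha> *s X (X e) + \<beta> *s X (Y e) + X (X w)"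
proof -
  obtain m where m: "m \<in> M" "Y (Y e) = X m" using Y2_XM e by blast
  obtain a b where ab: "a \<in> V" "b \<in> V" "m = X a + Y b" using m unfolding M_def by blast
  obtain r a1 b1 where a: "a1 \<in> V" "b1 \<in> V" "a = r *s e + (X a1 + Y b1)"
    using decompose[OF e ab(1)] by blast
  obtain s a2 b2 where b: "a2 \<in> V" "b2 \<in> V" "b = s *s e + (X a2 + Y b2)"
    using decompose[OF e ab(2)] by blast
  have "Y (X a2 + Y b2) \<in> X ` M" using YM_subset b unfolding M_def by blast
  then obtain w where w: "w \<in> M" "Y (X a2 + Y b2) = X w" by blast
  have "Y (Y e) = X (r *s X e + X (X a1 + Y b1) + (s *s Y e + Y (X a2 + Y b2)))"
    unfolding m ab a b by (simp only: X_add Y_add X_scale Y_scale)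
  also have "\<dots> = r *s X (X e) + s *s X (Y e) + X (X ((X a1 + Y b1) + w))"
    unfolding w by (simp add: X_add X_scale)
  finally have "Y (Y e) = r *s X (X e) + s *s X (Y e) + X (X ((X a1 + Y b1) + w))" .
  moreover have "(X a1 + Y b1) + w \<in> M"
    using a w XV_M YV_M by (intro subspace_add subspace_M) auto
  ultimately show ?thesis by blast
qed

text \<open>The companion matrix with rows (0, 1) and (\<alpha>, \<beta>) has determinant -\<alpha>,
  so a nonzero \<alpha> makes it invertible.\<close>

lemma quadratic_relation:
  assumes e: "e \<in> V" "e \<notin> M"
  shows "\<exists>\<alpha> \<beta>. \<exists>w\<in>M. \<alpha> \<noteq> 0 \<and> Y (Y e) = \<alpha> *s X (X e) + \<beta> *s X (Y e) + X (X w)"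
proof -
  obtain \<alpha> \<beta> w where w: "w \<in> M" "Y (Y e) = \<alpha> *s X (X e) + \<beta> *s X (Y e) + X (X w)"
    using quadratic_relation_aux[OF e] by blast
  show ?thesis
  proof (cases "\<alpha> = 0")
    case True
    \<comment> \<open>Then \<open>X\<^sup>2 e\<close> is a multiple of \<open>X Y e\<close> modulo \<open>X\<^sup>2 M\<close> as well, and this second relation,
      which has a nonzero \<open>X\<^sup>2 e\<close> term, can be added to the first.\<close>
    obtain \<gamma> \<delta> w' where w': "w' \<in> M" "X (X e) = \<gamma> *s Y (Y e) + \<delta> *s Y (X e) + Y (Y w')"
      using corank2_pair.quadratic_relation_aux[OF swap2, unfolded M_swap, OF e] by blast
    obtain w1 where w1: "w1 \<in> M" "Y w' = X w1" using XM_eq_YM w' by blast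
    obtain w2 where w2: "w2 \<in> M" "Y w1 = X w2" using XM_eq_YM w1 by blast
    have YYw': "Y (Y w') = X (X w2)" using w1 w2 by (metis comm)
    \<comment> \<open>\<open>X (X z)\<close> is the X^2 M part of \<open>Y (Y e) - X (X e)\<close>
      after the first relation is inserted into the second.\<close>
    define z where "z = w - \<gamma> *s w - w2"
    have "Y (Y e) = 1 *s X (X e) + (\<beta> - (\<gamma> * \<beta> + \<delta>)) *s X (Y e) + X (X z)"
      unfolding w'(2) YYw' z_def using w(2) True
      by (simp add: X_diff X_add X_scale scale_right_distrib scale_left_diff_distrib scale_left_distrib
          comm algebra_simps)
    moreover have "z \<in> M"
      unfolding z_def by (intro subspace_diff subspace_scale subspace_M w w2)
    ultimately show ?thesis by (metis one_neq_zero)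
  qed (use w in blast)
qed

text \<open>Applying \<open>Y\<close> and rewriting \<open>Y (Y e)\<close> multiplies the row (u, v)
  by the companion matrix, while Y M = X M keeps the error term in the right power. Exponents start
  at \<open>Suc k\<close> because the middle term has one \<open>X\<close> less.\<close>

lemma Y_pow_generator:
  assumes w: "w \<in> M" "Y (Y e) = \<alpha> *s X (X e) + \<beta> *s X (Y e) + X (X w)"
    and uv0: "u 0 = 1" "v 0 = 0"
    and uv: "\<And>k. u (Suc k) = v k * \<alpha>" "\<And>k. v (Suc k) = u k + v k * \<beta>"
  shows "\<exists>m\<in>M. (Y ^^ Suc k) e = u (Suc k) *s (X ^^ Suc k) e + v (Suc k) *s (X ^^ k) (Y e)
     + (X ^^ Suc k) m"
proof (induction k)
  case 0
  show ?case using subspace_0[OF subspace_M] by (auto simp: uv uv0 X_0 intro!: bexI[of _ 0])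
next
  case (Suc k)
  then obtain m where m: "m \<in> M" "(Y ^^ Suc k) e = u (Suc k) *s (X ^^ Suc k) e
      + v (Suc k) *s (X ^^ k) (Y e) + (X ^^ Suc k) m" by blast
  obtain m' where m': "m' \<in> M" "Y m = X m'" using XM_eq_YM m by blast
  have "(Y ^^ Suc (Suc k)) e = u (Suc k) *s (X ^^ Suc k) (Y e)
      + v (Suc k) *s (X ^^ k) (Y (Y e)) + (X ^^ Suc k) (Y m)"
    unfolding funpow.simps(2)[of "Suc k" Y] comp_def m(2) by (simp only: Y_add Y_scale Y_X_pow)
  also have "\<dots> = u (Suc (Suc k)) *s (X ^^ Suc (Suc k)) e
      + v (Suc (Suc k)) *s (X ^^ Suc k) (Y e) + (X ^^ Suc (Suc k)) (v (Suc k) *s w + m')"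
    unfolding w(2) m'(2) uv(1)[of "Suc k"] uv(2)[of "Suc k"]
    by (simp add: X_pow_add X_pow_scale X_add X_scale funpow_swap1 scale_right_distrib
        scale_left_distrib algebra_simps del: uv)
  finally show ?case
    using subspace_add[OF subspace_M subspace_scale[OF subspace_M w(1)] m'(1)] by blast
qed

text \<open>The pairs \<open>(u k, v k)\<close> are the first rows of the powers of the companion matrix with rows
  \<open>(0, 1)\<close> and \<open>(\<alpha>, \<beta>)\<close>.\<close>

lemma companion_pow_not_scalar:
  assumes k: "0 < k" and Yk: "\<And>v. v \<in> V \<Longrightarrow> (Y ^^ k) v = 0" and Xk: "\<exists>v\<in>V. (X ^^ k) v \<noteq> 0"
  obtains \<alpha> \<beta> :: 'k where "\<alpha> \<noteq> 0"
    and "\<And>u v. \<lbrakk>u 0 = 1; v 0 = 0; \<And>j. u (Suc j) = v j * \<alpha>; \<And>j. v (Suc j) = u j + v j * \<beta>;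
      v k = 0\<rbrakk> \<Longrightarrow> u k = 0"
proof -
  obtain e where e: "e \<in> V" "e \<notin> M" using ex_generator by blast
  obtain \<alpha> \<beta> w where w: "w \<in> M" "\<alpha> \<noteq> 0" "Y (Y e) = \<alpha> *s X (X e) + \<beta> *s X (Y e) + X (X w)"
    using quadratic_relation[OF e] by blast
  have XkM: "(X ^^ k) m = 0" if "m \<in> M" for m
    using X_pow_M_eq_0[of k m] Yk M_V that by blast
  \<comment> \<open>X^k kills \<open>M\<close> but not V = K e + M.\<close>
  have Xke: "(X ^^ k) e \<noteq> 0"
  proof
    assume Xke: "(X ^^ k) e = 0"
    have "(X ^^ k) x = 0" if x: "x \<in> V" for x
    proof -
      obtain r a b where d: "a \<in> V" "b \<in> V" "x = r *s e + (X a + Y b)"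
        using decompose[OF e x] by blast
      have "X a + Y b \<in> M" using d unfolding M_def by blast
      thus ?thesis using Xke XkM unfolding d(3) X_pow_add[of _ "r *s e"] by (simp add: X_pow_scale)
    qed
    with Xk show False by blast
  qed
  obtain j where j: "k = Suc j" using k by (cases k) auto
  show thesis
  proof (rule that[OF w(2)])
    fix u v
    assume uv: "u 0 = 1" "v 0 = 0" "\<And>j. u (Suc j) = v j * \<alpha>" "\<And>j. v (Suc j) = u j + v j * \<beta>"
      and vk: "v k = 0"
    obtain m where "m \<in> M" "(Y ^^ k) e = u k *s (X ^^ k) e + v k *s (X ^^ j) (Y e) + (X ^^ k) m"
      using Y_pow_generator[of w e \<alpha> \<beta> u v j, OF w(1,3) uv] unfolding j by blast
    thus "u k = 0" using Yk[OF e(1)] XkM vk Xke by simp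
  qed
qed

end

subsection \<open>Jordan matrices as linear maps on coordinate functions\<close>

definition fscale :: "'k::field \<Rightarrow> (nat \<Rightarrow> 'k) \<Rightarrow> nat \<Rightarrow> 'k" where
  "fscale c f = (\<lambda>i. c * f i)"

interpretation funs: scalar_space fscale
  by unfold_locales (auto simp: fscale_def fun_eq_iff algebra_simps)

text \<open>K^n as functions supported below \<open>n\<close>, so that the vectors for all
  \<open>n\<close> share one type that is an additive group.\<close>

definition coords :: "nat \<Rightarrow> (nat \<Rightarrow> 'k::field) set" where
  "coords n = {f. \<forall>i\<ge>n. f i = 0}"

lemma subspace_coords: "funs.subspace (coords n)"
  by (auto simp: funs.subspace_def coords_def fscale_def)

definition mat_op :: "nat \<Rightarrow> 'k::field mat \<Rightarrow> (nat \<Rightarrow> 'k) \<Rightarrow> nat \<Rightarrow> 'k" where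
  "mat_op n A f = (\<lambda>i. if i < n then \<Sum>j<n. A $$ (i, j) * f j else 0)"

lemma mat_op_coords: "mat_op n A f \<in> coords n"
  by (simp add: mat_op_def coords_def)

lemma mat_op_add: "mat_op n A (f + g) = mat_op n A f + mat_op n A g"
  by (auto simp: mat_op_def fun_eq_iff distrib_left sum.distrib)

lemma mat_op_scale: "mat_op n A (fscale c f) = fscale c (mat_op n A f)"
  by (auto simp: mat_op_def fscale_def fun_eq_iff sum_distrib_left mult.left_commute intro: sum.cong)

lemma mat_op_one: "f \<in> coords n \<Longrightarrow> mat_op n (1\<^sub>m n) f = f"
  by (auto simp: mat_op_def coords_def fun_eq_iff sum.delta if_distrib[of "\<lambda>x. x * _"] cong: if_cong)

lemma mat_op_mult:
  assumes "A \<in> carrier_mat n n" "B \<in> carrier_mat n n"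
  shows "mat_op n (A * B) f = mat_op n A (mat_op n B f)"
proof
  fix i
  have "(\<Sum>j<n. (A * B) $$ (i, j) * f j) = (\<Sum>j<n. A $$ (i, j) * (\<Sum>k<n. B $$ (j, k) * f k))"
    if i: "i < n"
  proof -
    have "(\<Sum>j<n. (A * B) $$ (i, j) * f j) = (\<Sum>j<n. \<Sum>k<n. A $$ (i, k) * B $$ (k, j) * f j)"
      using assms i by (intro sum.cong refl)
        (auto simp: scalar_prod_def sum_distrib_right lessThan_atLeast0)
    also have "\<dots> = (\<Sum>k<n. \<Sum>j<n. A $$ (i, k) * B $$ (k, j) * f j)" by (rule sum.swap)
    finally show ?thesis by (simp add: sum_distrib_left mult.assoc)
  qed
  thus "mat_op n (A * B) f i = mat_op n A (mat_op n B f) i"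
    by (simp add: mat_op_def)
qed

text \<open>The nilpotent Jordan matrix with blocks of sizes \<open>a\<close> and
  \<open>n - a\<close>: every coordinate moves down by one, but not across the end of a block. For
  \<open>a = n\<close> there is a single block.\<close>

definition jordan_shift :: "nat \<Rightarrow> nat \<Rightarrow> (nat \<Rightarrow> 'k::field) \<Rightarrow> nat \<Rightarrow> 'k" where
  "jordan_shift n a f = (\<lambda>i. if Suc i < n \<and> Suc i \<noteq> a then f (Suc i) else 0)"

lemma mat_op_shift:
  assumes "\<And>i j. i < n \<Longrightarrow> j < n \<Longrightarrow> J $$ (i, j) = (if j = Suc i \<and> j \<noteq> a then 1 else 0)"
  shows "mat_op n J f = jordan_shift n a f"
proof
  fix i
  have "(\<Sum>j<n. J $$ (i, j) * f j) = (\<Sum>j<n. if j = Suc i then if Suc i \<noteq> a then f (Suc i) else 0 else 0)"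
    if "i < n" using that assms by (intro sum.cong) auto
  thus "mat_op n J f i = jordan_shift n a f i"
    by (auto simp: mat_op_def jordan_shift_def)
qed

lemma jordan_shift_pow:
  assumes "f \<in> coords n" "a \<le> n"
  shows "(jordan_shift n a ^^ k) f i = (if i + k < a \<or> a \<le> i \<and> i + k < n then f (i + k) else 0)"
proof (induction k arbitrary: i)
  case 0
  show ?case using assms by (auto simp: coords_def)
next
  case (Suc k)
  have "(jordan_shift n a ^^ Suc k) f i
      = (if Suc i < n \<and> Suc i \<noteq> a then (jordan_shift n a ^^ k) f (Suc i) else 0)"
    by (simp add: jordan_shift_def[of n a "(jordan_shift n a ^^ k) f"])
  with assms(2) show ?case by (auto simp: Suc)
qed

text \<open>\<open>T\<close> is conjugate to a nilpotent matrix with Jordan blocks of sizes \<open>a\<close> and \<open>b\<close>; the second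
  block is absent if \<open>b = 0\<close>.\<close>

locale jordan_op =
  fixes n a b :: nat and T P Q :: "(nat \<Rightarrow> 'k::field) \<Rightarrow> nat \<Rightarrow> 'k"
  assumes n: "n = a + b" and ba: "b \<le> a" and a0: "0 < a"
    and P_V: "f \<in> coords n \<Longrightarrow> P f \<in> coords n" and Q_V: "f \<in> coords n \<Longrightarrow> Q f \<in> coords n"
    and PQ: "f \<in> coords n \<Longrightarrow> P (Q f) = f" and QP: "f \<in> coords n \<Longrightarrow> Q (P f) = f"
    and P_add: "P (f + g) = P f + P g" and P_scale: "P (fscale c f) = fscale c (P f)"
    and Q_add: "Q (f + g) = Q f + Q g" and Q_scale: "Q (fscale c f) = fscale c (Q f)"
    and T: "T f = P (jordan_shift n a (Q f))"
begin

lemma shift_V: "jordan_shift n a f \<in> coords n"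
  by (auto simp: coords_def jordan_shift_def)

lemma T_pow:
  assumes "f \<in> coords n"
  shows "(T ^^ k) f = P ((jordan_shift n a ^^ k) (Q f))"
proof (induction k)
  case (Suc k)
  have "(jordan_shift n a ^^ k) (Q f) \<in> coords n"
    using Q_V[OF assms] shift_V by (cases k) auto
  with Suc show ?case by (simp add: T QP)
qed (simp add: PQ assms)

lemma P_0: "P 0 = 0"
  using P_scale[of 0 0] by (simp add: fscale_def zero_fun_def)

lemma T_pow_eq_0:
  assumes "f \<in> coords n" "a \<le> k"
  shows "(T ^^ k) f = 0"
proof -
  have "(jordan_shift n a ^^ k) (Q f) = 0"
    using assms Q_V jordan_shift_pow[of "Q f" n a k] n ba by (auto simp: fun_eq_iff)
  thus ?thesis using T_pow assms P_0 by simp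
qed

lemma T_pow_neq_0:
  assumes "k < a"
  shows "\<exists>f\<in>coords n. (T ^^ k) f \<noteq> 0"
proof
  define g :: "nat \<Rightarrow> 'k" where "g = (\<lambda>i. if i = k then 1 else 0)"
  have g: "g \<in> coords n" using assms n by (auto simp: g_def coords_def)
  show "P g \<in> coords n" by (rule P_V[OF g])
  have h: "(jordan_shift n a ^^ k) g 0 = 1"
    using jordan_shift_pow[OF g, of a k 0] assms n by (simp add: g_def)
  show "(T ^^ k) (P g) \<noteq> 0"
  proof
    assume "(T ^^ k) (P g) = 0"
    hence "P ((jordan_shift n a ^^ k) g) = P 0" using T_pow[OF P_V[OF g]] g QP P_0 by simp
    hence "Q (P ((jordan_shift n a ^^ k) g)) = Q (P 0)" by simp
    moreover have "(jordan_shift n a ^^ k) g \<in> coords n" using g shift_V by (cases k) auto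
    moreover have "(0 :: nat \<Rightarrow> 'k) \<in> coords n" by (simp add: coords_def)
    ultimately have "(jordan_shift n a ^^ k) g = 0" by (simp add: QP)
    with h show False by simp
  qed
qed

lemma T_pow_eq_0_iff: "(\<forall>f\<in>coords n. (T ^^ k) f = 0) \<longleftrightarrow> a \<le> k"
  using T_pow_eq_0 T_pow_neq_0 by (meson not_le)

text \<open>The shift produces zero exactly at the last position of each block; for
  \<open>b = 0\<close> the two conditions coincide.\<close>

lemma mem_range_T:
  assumes f: "f \<in> coords n"
  shows "f \<in> T ` coords n \<longleftrightarrow> Q f (a - 1) = 0 \<and> Q f (n - 1) = 0"
proof
  assume "f \<in> T ` coords n"
  then obtain g where "f = T g" by blast
  hence "Q f = jordan_shift n a (Q g)" by (simp add: T QP[OF shift_V])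
  thus "Q f (a - 1) = 0 \<and> Q f (n - 1) = 0" using a0 by (auto simp: jordan_shift_def)
next
  assume Qf: "Q f (a - 1) = 0 \<and> Q f (n - 1) = 0"
  define g where "g = (\<lambda>i. if 0 < i \<and> i < n then Q f (i - 1) else 0)"
  have g: "g \<in> coords n" by (auto simp: g_def coords_def)
  have "Q f i = jordan_shift n a g i" for i
  proof (cases "i < n")
    case True
    with Qf show ?thesis by (cases "Suc i = n"; cases "Suc i = a")
      (auto simp: jordan_shift_def g_def)
  next
    case False
    thus ?thesis using Q_V[OF f] by (auto simp: jordan_shift_def coords_def)
  qed
  hence "jordan_shift n a g = Q f" by auto
  hence "T (P g) = f" by (simp add: T QP[OF g] PQ[OF f])
  thus "f \<in> T ` coords n" using P_V[OF g] by force
qed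

lemma codim_le2_range: "funs.codim_le2 (coords n) (T ` coords n)"
  unfolding funs.codim_le2_def
proof (intro ballI)
  fix x y z :: "nat \<Rightarrow> 'k" assume xyz: "x \<in> coords n" "y \<in> coords n" "z \<in> coords n"
  have dep: "\<exists>r s t. (r \<noteq> 0 \<or> s \<noteq> 0 \<or> t \<noteq> 0) \<and> r * x1 + s * y1 + t * z1 = 0 \<and> r * x2 + s * y2 + t * z2 = 0"
    for x1 x2 y1 y2 z1 z2 :: 'k
  proof -
    \<comment> \<open>The cross product of the rows (x1, y1, z1) and (x2, y2, z2); if it vanishes, a
      relation between the first two vectors is used.\<close>
    let ?r = "y1 * z2 - y2 * z1" and ?s = "z1 * x2 - z2 * x1" and ?t = "x1 * y2 - x2 * y1"
    consider "?r \<noteq> 0 \<or> ?s \<noteq> 0 \<or> ?t \<noteq> 0" | "?t = 0" "y1 \<noteq> 0 \<or> x1 \<noteq> 0"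
      | "?t = 0" "y2 \<noteq> 0 \<or> x2 \<noteq> 0" | "x1 = 0" "y1 = 0" "x2 = 0" "y2 = 0" by auto
    thus ?thesis
    proof cases
      case 1
      thus ?thesis by (intro exI[of _ ?r] exI[of _ ?s] exI[of _ ?t]) (auto simp: algebra_simps)
    next
      case 2
      thus ?thesis by (intro exI[of _ y1] exI[of _ "- x1"] exI[of _ 0]) (auto simp: algebra_simps)
    next
      case 3
      thus ?thesis by (intro exI[of _ y2] exI[of _ "- x2"] exI[of _ 0]) (auto simp: algebra_simps)
    next
      case 4
      thus ?thesis by (intro exI[of _ 1] exI[of _ 0]) auto
    qed
  qed
  obtain r s t where rst: "r \<noteq> 0 \<or> s \<noteq> 0 \<or> t \<noteq> 0"
      "r * Q x (a - 1) + s * Q y (a - 1) + t * Q z (a - 1) = 0"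
      "r * Q x (n - 1) + s * Q y (n - 1) + t * Q z (n - 1) = 0"
    using dep by blast
  have "fscale r x + fscale s y + fscale t z \<in> coords n"
    using xyz by (intro funs.subspace_add funs.subspace_scale subspace_coords)
  hence "fscale r x + fscale s y + fscale t z \<in> T ` coords n"
    using rst by (simp add: mem_range_T Q_add Q_scale) (simp add: fscale_def)
  thus "\<exists>r s t. (r \<noteq> 0 \<or> s \<noteq> 0 \<or> t \<noteq> 0) \<and> fscale r x + fscale s y + fscale t z \<in> T ` coords n"
    using rst by blast
qed

text \<open>The last basis vectors of the two blocks are independent modulo the image;
  \<open>0 < b\<close> keeps their positions apart.\<close>

lemma codim_ge2_range:
  assumes b: "0 < b"
  shows "funs.codim_ge2 (coords n) (T ` coords n)"
  unfolding funs.codim_ge2_def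
proof -
  define g h :: "nat \<Rightarrow> 'k" where "g = (\<lambda>i. if i = a - 1 then 1 else 0)"
    and "h = (\<lambda>i. if i = n - 1 then 1 else 0)"
  have gh: "g \<in> coords n" "h \<in> coords n" using a0 n by (auto simp: g_def h_def coords_def)
  have "r = 0 \<and> s = 0" if mem: "fscale r (P g) + fscale s (P h) \<in> T ` coords n" for r s
  proof -
    have "fscale r (P g) + fscale s (P h) \<in> coords n"
      by (intro funs.subspace_add funs.subspace_scale subspace_coords P_V gh)
    moreover have "Q (fscale r (P g) + fscale s (P h)) = fscale r g + fscale s h"
      by (simp add: Q_add Q_scale QP gh)
    ultimately have "(fscale r g + fscale s h) (a - 1) = 0 \<and> (fscale r g + fscale s h) (n - 1) = 0"
      using mem_range_T mem by metis
    moreover have "a - 1 \<noteq> n - 1" using a0 b n by simp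
    ultimately show ?thesis by (auto simp: fscale_def g_def h_def)
  qed
  thus "\<exists>x\<in>coords n. \<exists>y\<in>coords n. \<forall>r s. fscale r x + fscale s y \<in> T ` coords n \<longrightarrow> r = 0 \<and> s = 0"
    using gh P_V by blast
qed

text \<open>The shift to the power \<open>a - 1\<close> kills the shorter block and moves the last
  coordinate of the longer one to position 0.\<close>

lemma rank_one_T_pow:
  assumes "b < a"
  shows "\<exists>z. \<forall>f\<in>coords n. \<exists>r. (T ^^ (a - 1)) f = fscale r z"
proof -
  define g :: "nat \<Rightarrow> 'k" where "g = (\<lambda>i. if i = 0 then 1 else 0)"
  have "(T ^^ (a - 1)) f = fscale (Q f (a - 1)) (P g)" if f: "f \<in> coords n" for f
  proof -
    have "(jordan_shift n a ^^ (a - 1)) (Q f) = fscale (Q f (a - 1)) g"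
      using jordan_shift_pow[OF Q_V[OF f], of a "a - 1"] n assms
      by (auto simp: fun_eq_iff fscale_def g_def)
    thus ?thesis by (simp add: T_pow[OF f] P_scale)
  qed
  thus ?thesis by blast
qed

lemma cyclic_T:
  assumes b: "b = 0"
  shows "\<exists>e\<in>coords n. \<forall>v\<in>coords n. \<exists>r. \<exists>w\<in>coords n. v = fscale r e + T w"
proof -
  define g :: "nat \<Rightarrow> 'k" where "g = (\<lambda>i. if i = n - 1 then 1 else 0)"
  have g: "g \<in> coords n" using a0 n by (auto simp: g_def coords_def)
  have "\<exists>r. \<exists>w\<in>coords n. v = fscale r (P g) + T w" if v: "v \<in> coords n" for v
  proof -
    define r where "r = Q v (n - 1)"
    have "v + fscale (- r) (P g) \<in> coords n"
      using v by (intro funs.subspace_add funs.subspace_scale subspace_coords P_V g)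
    moreover have "Q (v + fscale (- r) (P g)) = Q v + fscale (- r) g"
      by (simp only: Q_add Q_scale QP g)
    hence "Q (v + fscale (- r) (P g)) (n - 1) = 0" by (simp add: fscale_def g_def r_def)
    ultimately have "v + fscale (- r) (P g) \<in> T ` coords n"
      using b n mem_range_T by simp
    then obtain w where w: "w \<in> coords n" "v + fscale (- r) (P g) = T w" by blast
    have "v = fscale r (P g) + T w" unfolding w(2)[symmetric] by (auto simp: fscale_def fun_eq_iff)
    with w show ?thesis by blast
  qed
  with P_V[OF g] show ?thesis by blast
qed

end

lemma jordan_matrix_two_index:
  assumes "i < a + b" "j < a + b"
  shows "jordan_matrix [(a, 0), (b, 0)] $$ (i, j) = (if j = Suc i \<and> j \<noteq> a then 1 else 0 :: 'k::field)"
  using assms by (auto simp: jordan_matrix_def Let_def)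

lemma jordan_matrix_one_index:
  assumes "i < a" "j < a"
  shows "jordan_matrix [(a, 0)] $$ (i, j) = (if j = Suc i then 1 else 0 :: 'k::field)"
  using assms by (auto simp: jordan_matrix_def Let_def)

lemma nilpotent_class_jordan_op:
  fixes X :: "'k::field mat"
  assumes X: "X \<in> nilpotent_class lam" and lam: "lam = [a] \<and> b = 0 \<or> lam = [a, b]"
    and n: "n = a + b" and ba: "b \<le> a" and a0: "0 < a"
  shows "\<exists>P Q. jordan_op n a b (mat_op n X) P Q"
proof -
  define J :: "'k mat" where "J = jordan_matrix (map (\<lambda>k. (k, 0)) lam)"
  have Xc: "X \<in> carrier_mat n n" using X lam n by (auto simp: nilpotent_class_def)
  obtain P Q where "similar_mat_wit X J P Q"
    using X by (auto simp: nilpotent_class_def jordan_nf_def similar_mat_def J_def)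
  note D = similar_mat_witD2[OF Xc this]
  have "J $$ (i, j) = (if j = Suc i \<and> j \<noteq> a then 1 else 0)" if "i < n" "j < n" for i j
    using lam that n jordan_matrix_two_index[of i a b j] jordan_matrix_one_index[of i a j]
    unfolding J_def by auto
  hence "mat_op n J f = jordan_shift n a f" for f by (rule mat_op_shift)
  hence "mat_op n X f = mat_op n P (jordan_shift n a (mat_op n Q f))" for f
    unfolding D(3) using D by (simp add: mat_op_mult[of _ n])
  moreover have "mat_op n P (mat_op n Q f) = f" "mat_op n Q (mat_op n P f) = f" if "f \<in> coords n" for f
    using D mat_op_one[OF that] by (simp_all flip: mat_op_mult)
  ultimately have "jordan_op n a b (mat_op n X) (mat_op n P) (mat_op n Q)"
    using n ba a0 by unfold_locales (auto simp: mat_op_coords mat_op_add mat_op_scale)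
  thus ?thesis by blast
qed

subsection \<open>The exponent of the projective linear group\<close>

lemma GL_pow:
  assumes "A \<in> carrier_mat d d"
  shows "A [^]\<^bsub>GL d (K :: 'a::field itself)\<^esub> (k :: nat) = A ^\<^sub>m k"
  using assms by (induction k) (auto simp: GL_def units_of_def ring_mat_simps nat_pow_def)

lemma finite_carrier_mat:
  assumes "finite (UNIV :: 'a set)"
  shows "finite (carrier_mat nr nc :: 'a mat set)"
proof (rule finite_subset)
  let ?F = "{0..<nr} \<times> {0..<nc} \<rightarrow>\<^sub>E (UNIV :: 'a set)"
  show "finite ((\<lambda>f. mat nr nc f) ` ?F)" using assms by (intro finite_imageI finite_PiE) auto
  show "carrier_mat nr nc \<subseteq> (\<lambda>f. mat nr nc f) ` ?F"
  proof
    fix A :: "'a mat" assume A: "A \<in> carrier_mat nr nc"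
    have "A = mat nr nc (restrict (\<lambda>ij. A $$ ij) ({0..<nr} \<times> {0..<nc}))"
      using A by (intro eq_matI) auto
    moreover have "restrict (\<lambda>ij. A $$ ij) ({0..<nr} \<times> {0..<nc}) \<in> ?F" by auto
    ultimately show "A \<in> (\<lambda>f. mat nr nc f) ` ?F" by (metis image_eqI)
  qed
qed

text \<open>The group order satisfies the condition under \<open>LEAST\<close> by Lagrange, so the
  least value satisfies it as well.\<close>

lemma group_exponent_pow:
  assumes "group G" "finite (carrier G)" "g \<in> carrier G" "group_exponent G dvd m"
  shows "g [^]\<^bsub>G\<^esub> m = \<one>\<^bsub>G\<^esub>"
proof -
  interpret group G by fact
  have "0 < order G \<and> (\<forall>g\<in>carrier G. g [^]\<^bsub>G\<^esub> order G = \<one>\<^bsub>G\<^esub>)"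
    using assms(2) pow_order_eq_1 order_gt_0_iff_finite by blast
  hence "\<forall>g\<in>carrier G. g [^]\<^bsub>G\<^esub> group_exponent G = \<one>\<^bsub>G\<^esub>"
    unfolding group_exponent_def by (rule LeastI2) auto
  moreover obtain k where "m = group_exponent G * k" using assms(4) by blast
  ultimately show ?thesis using assms(3) by (simp flip: nat_pow_pow)
qed

lemma pow_scalar_of_PGL_exponent:
  fixes C :: "'k::field mat"
  assumes fin: "finite (UNIV :: 'k set)" and dvd: "group_exponent (PGL d TYPE('k)) dvd m"
    and C: "C \<in> carrier (GL d TYPE('k))"
  shows "C ^\<^sub>m m \<in> nonzero_scalar_mats d TYPE('k)"
proof -
  let ?G = "GL d TYPE('k)" and ?H = "nonzero_scalar_mats d TYPE('k)"
  interpret G: group ?G by (rule group_GL)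
  interpret H: normal ?H ?G by (rule normal_nonzero_scalar_mats)
  have "finite (carrier ?G)"
    by (rule finite_subset[OF _ finite_carrier_mat[OF fin, of d d]]) (auto simp: carrier_GL)
  hence "finite (carrier (PGL d TYPE('k)))" by (simp add: PGL_def carrier_FactGroup)
  moreover have "?H #>\<^bsub>?G\<^esub> C \<in> carrier (PGL d TYPE('k))"
    using C by (simp add: PGL_def carrier_FactGroup)
  ultimately have "(?H #>\<^bsub>?G\<^esub> C) [^]\<^bsub>PGL d TYPE('k)\<^esub> m = \<one>\<^bsub>PGL d TYPE('k)\<^esub>"
    by (intro group_exponent_pow group_PGL dvd)
  hence "?H #>\<^bsub>?G\<^esub> (C [^]\<^bsub>?G\<^esub> m) = ?H"
    using H.FactGroup_pow[OF C, of m] by (simp add: PGL_def)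
  hence "C [^]\<^bsub>?G\<^esub> m \<in> ?H"
    by (rule G.coset_join1) (use C in \<open>auto intro: H.subgroup_axioms\<close>)
  thus ?thesis using GL_pow[of C d "TYPE('k)" m] C by (auto simp: carrier_GL)
qed

text \<open>\<open>u\<close> and \<open>v\<close> form the first row of the powers of the companion
  matrix \<open>C\<close>, and the recursion is right multiplication by \<open>C\<close>. If C^m is
  a scalar \<open>c\<close>, then \<open>v m = 0\<close> and \<open>u m = c\<close>.\<close>

lemma PGL_exponent_companion:
  fixes \<alpha> \<beta> :: "'k::field"
  assumes fin: "finite (UNIV :: 'k set)" and dvd: "group_exponent (PGL 2 TYPE('k)) dvd m"
    and \<alpha>: "\<alpha> \<noteq> 0"
  shows "\<exists>u v. u 0 = 1 \<and> v 0 = 0 \<and> (\<forall>j. u (Suc j) = v j * \<alpha>) \<and> (\<forall>j. v (Suc j) = u j + v j * \<beta>)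
    \<and> v m = 0 \<and> u m \<noteq> 0"
proof -
  define C where "C = mat 2 2 (\<lambda>(i, j). if i = 0 then (if j = 0 then 0 else 1) else (if j = 0 then \<alpha> else \<beta>))"
  \<comment> \<open>The inverse of \<open>C\<close>.\<close>
  define D where "D = mat 2 2 (\<lambda>(i, j). if i = 0 then (if j = 0 then - \<beta> / \<alpha> else 1 / \<alpha>) else (if j = 0 then 1 else 0))"
  have CD: "C \<in> carrier_mat 2 2" "D \<in> carrier_mat 2 2" by (auto simp: C_def D_def)
  have "C * D = 1\<^sub>m 2" "D * C = 1\<^sub>m 2"
    using \<alpha> by (auto intro!: eq_matI simp: C_def D_def scalar_prod_def less_2_cases_iff numeral_2_eq_2)
  with CD have "C \<in> carrier (GL 2 TYPE('k))" by (auto simp: carrier_GL)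
  from pow_scalar_of_PGL_exponent[OF fin dvd this]
  obtain c where c: "c \<noteq> 0" "C ^\<^sub>m m = c \<cdot>\<^sub>m 1\<^sub>m 2" unfolding nonzero_scalar_mats_def by blast
  define u v where "u = (\<lambda>k. (C ^\<^sub>m k) $$ (0, 0))" and "v = (\<lambda>k. (C ^\<^sub>m k) $$ (0, 1))"
  have Ck: "C ^\<^sub>m k \<in> carrier_mat 2 2" for k using CD by simp
  have "(A * C) $$ (0, 0) = A $$ (0, 1) * \<alpha>" "(A * C) $$ (0, 1) = A $$ (0, 0) + A $$ (0, 1) * \<beta>"
    if "A \<in> carrier_mat 2 2" for A
    using that by (auto simp: C_def scalar_prod_def numeral_2_eq_2)
  from this[OF Ck] have "u (Suc k) = v k * \<alpha>" "v (Suc k) = u k + v k * \<beta>" for k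
    by (simp_all add: u_def v_def)
  moreover have "u 0 = 1" "v 0 = 0" using CD by (auto simp: u_def v_def)
  moreover have "v m = 0" "u m \<noteq> 0" using c by (auto simp: u_def v_def)
  ultimately show ?thesis by blast
qed

subsection \<open>Partitions with at most two parts\<close>

lemma commuting_jordan_ops:
  fixes X Y :: "'k::field mat"
  assumes X: "jordan_op n a b (mat_op n X) P Q" and Y: "jordan_op n c d (mat_op n Y) P' Q'"
    and XY: "X \<in> carrier_mat n n" "Y \<in> carrier_mat n n" "X * Y = Y * X"
  shows "commuting_pair fscale (coords n) (mat_op n X) (mat_op n Y)"
proof -
  have "\<exists>N. \<forall>v\<in>coords n. (mat_op n X ^^ N) v = 0" "\<exists>N. \<forall>v\<in>coords n. (mat_op n Y ^^ N) v = 0"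
    using jordan_op.T_pow_eq_0[OF X] jordan_op.T_pow_eq_0[OF Y] by blast+
  thus ?thesis
    using mat_op_mult[OF XY(1,2)] mat_op_mult[OF XY(2,1)]
    by unfold_locales (auto simp: mat_op_add mat_op_scale mat_op_coords subspace_coords XY(3))
qed

lemma commuting_with_cyclic:
  assumes X: "jordan_op n n 0 (mat_op n X) P Q" and Y: "jordan_op n c d (mat_op n Y) P' Q'"
    and comm: "commuting_pair fscale (coords n) (mat_op n X) (mat_op n Y)" and d: "0 < d"
  shows "c = d \<or> c = d + 1"
proof -
  interpret X: jordan_op n n 0 "mat_op n X" P Q by (rule X)
  interpret Y: jordan_op n c d "mat_op n Y" P' Q' by (rule Y)
  interpret C: commuting_pair fscale "coords n" "mat_op n X" "mat_op n Y" by (rule comm)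
  obtain e where "e \<in> coords n"
    "\<And>v. v \<in> coords n \<Longrightarrow> \<exists>r. \<exists>w\<in>coords n. v = fscale r e + mat_op n X w"
    using X.cyclic_T by auto
  from C.cyclic_nilpotency[OF this Y.codim_le2_range Y.codim_ge2_range[OF d]]
  have iff: "c \<le> k \<longleftrightarrow> n \<le> 2 * k" for k
    unfolding X.T_pow_eq_0_iff Y.T_pow_eq_0_iff .
  \<comment> \<open>\<open>c\<close> is the least \<open>k\<close> with
    \<open>n \<le> 2 * k\<close>; as \<open>c\<close> is positive, \<open>c - 1\<close> fails, and n
    = c + d leaves c - d \<le> 1.\<close>
  have "n \<le> 2 * c" "\<not> n \<le> 2 * (c - 1)" using iff[of c] iff[of "c - 1"] Y.a0 by auto
  thus ?thesis using Y.n Y.ba by linarith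
qed

lemma commuting_two_blocks:
  fixes X Y :: "'k::field mat"
  assumes X: "jordan_op n a b (mat_op n X) P Q" and Y: "jordan_op n c d (mat_op n Y) P' Q'"
    and comm: "commuting_pair fscale (coords n) (mat_op n X) (mat_op n Y)"
    and b: "0 < b" and d: "0 < d" and ca: "c < a"
  shows "c = d" "a = c + 1"
    and "finite (UNIV :: 'k set) \<Longrightarrow> \<not> group_exponent (PGL 2 TYPE('k)) dvd c"
proof -
  interpret X: jordan_op n a b "mat_op n X" P Q by (rule X)
  interpret Y: jordan_op n c d "mat_op n Y" P' Q' by (rule Y)
  interpret C: commuting_pair fscale "coords n" "mat_op n X" "mat_op n Y" by (rule comm)
  \<comment> \<open>Equal images would make the images of all powers equal, so X^c = 0, against
    \<open>c < a\<close>.\<close>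
  have "mat_op n X ` coords n \<noteq> mat_op n Y ` coords n"
  proof
    assume "mat_op n X ` coords n = mat_op n Y ` coords n"
    hence "(mat_op n X ^^ c) ` coords n = (mat_op n Y ^^ c) ` coords n" by (rule C.X_pow_image_eq)
    moreover have "\<forall>f\<in>coords n. (mat_op n Y ^^ c) f = 0" by (simp add: Y.T_pow_eq_0_iff)
    ultimately have "\<forall>f\<in>coords n. (mat_op n X ^^ c) f = 0" by (metis imageE imageI)
    with ca show False by (simp add: X.T_pow_eq_0_iff)
  qed
  then interpret D: corank2_pair fscale "coords n" "mat_op n X" "mat_op n Y"
    by unfold_locales (intro X.codim_le2_range X.codim_ge2_range Y.codim_le2_range Y.codim_ge2_range b d)+
  have Xc: "\<exists>f\<in>coords n. (mat_op n X ^^ c) f \<noteq> 0" by (rule X.T_pow_neq_0[OF ca])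
  have Yc: "(mat_op n Y ^^ c) f = 0" if "f \<in> coords n" for f using that by (rule Y.T_pow_eq_0) simp
  have "\<forall>f\<in>coords n. (mat_op n X ^^ Suc c) f = 0" using D.nilpotency_le_Suc[of c] Yc by blast
  thus "a = c + 1" using ca unfolding X.T_pow_eq_0_iff by simp
  \<comment> \<open>For \<open>d < c\<close> the power \<open>c - 1\<close> of \<open>Y\<close> has
    rank one, which would force X^c = 0.\<close>
  show "c = d"
  proof (rule ccontr)
    assume "c \<noteq> d"
    hence dc: "d < c" using Y.ba by simp
    obtain z where "\<forall>f\<in>coords n. \<exists>r. (mat_op n Y ^^ (c - 1)) f = fscale r z"
      using Y.rank_one_T_pow[OF dc] by blast
    hence "(mat_op n X ^^ Suc (c - 1)) f = 0" if "f \<in> coords n" for f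
      using that Yc Y.a0 by (intro D.nilpotency_le_of_rank_one[of "c - 1" z]) auto
    with Xc Y.a0 show False by simp
  qed
  show "\<not> group_exponent (PGL 2 TYPE('k)) dvd c" if fin: "finite (UNIV :: 'k set)"
  proof
    assume dvd: "group_exponent (PGL 2 TYPE('k)) dvd c"
    obtain \<alpha> \<beta> :: 'k where ab: "\<alpha> \<noteq> 0"
      and comp: "\<And>u v. \<lbrakk>u 0 = 1; v 0 = 0; \<And>j. u (Suc j) = v j * \<alpha>;
        \<And>j. v (Suc j) = u j + v j * \<beta>; v c = 0\<rbrakk> \<Longrightarrow> u c = 0"
      using D.companion_pow_not_scalar[OF Y.a0 Yc Xc] by blast
    show False using PGL_exponent_companion[OF fin dvd ab, of \<beta>] comp by blast
  qed
qed

lemma partition_le2_cases: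
  assumes "is_partition lam n" "length lam \<le> 2"
  obtains "lam = []" "n = 0" | "lam = [n]" "0 < n"
    | a b where "lam = [a, b]" "n = a + b" "b \<le> a" "0 < b"
proof (cases lam)
  case (Cons a l)
  with assms show thesis
    by (cases l) (auto simp: is_partition_def intro: that)
qed (use assms that in \<open>auto simp: is_partition_def\<close>)

theorem theorem4p10:
  fixes lam mu :: "nat list" and n :: nat
  assumes "is_partition lam n" and "is_partition mu n"
    and "length lam \<le> 2" and "length mu \<le> 2"
    and "nilpotent_classes_commute TYPE('k::field) lam mu"
    and "Max (set lam) \<ge> Max (set mu)"
  shows "lam = mu
    \<or> (\<exists>m. n = 2 * m \<and> lam = [n] \<and> mu = [m, m])
    \<or> (\<exists>m. n = 2 * m \<and> lam = [m + 1, m - 1] \<and> mu = [m, m]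
          \<and> (finite (UNIV :: 'k set) \<longrightarrow> \<not> group_exponent (PGL 2 TYPE('k)) dvd m))
    \<or> (\<exists>m. n = 2 * m + 1 \<and> lam = [n] \<and> mu = [m + 1, m])"
proof -
  obtain X Y :: "'k mat" where XY: "X \<in> nilpotent_class lam" "Y \<in> nilpotent_class mu" "X * Y = Y * X"
    using assms(5) by (auto simp: nilpotent_classes_commute_def)
  have "sum_list lam = n" "sum_list mu = n" using assms(1,2) by (auto simp: is_partition_def)
  hence carrier: "X \<in> carrier_mat n n" "Y \<in> carrier_mat n n"
    using XY by (auto simp: nilpotent_class_def)
  show ?thesis
    using assms(1,3)
  proof (cases rule: partition_le2_cases)
    case 1
    with assms(2,4) show ?thesis by (cases rule: partition_le2_cases) auto
  next
    case lam: 2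
    show ?thesis
      using assms(2,4)
    proof (cases rule: partition_le2_cases)
      case mu: (3 c d)
      obtain P Q where X: "jordan_op n n 0 (mat_op n X) P Q"
        using nilpotent_class_jordan_op[OF XY(1), of n 0 n] lam by auto
      obtain P' Q' where Y: "jordan_op n c d (mat_op n Y) P' Q'"
        using nilpotent_class_jordan_op[OF XY(2), of c d n] mu by auto
      have "c = d \<or> c = d + 1"
        by (rule commuting_with_cyclic[OF X Y commuting_jordan_ops[OF X Y carrier XY(3)] mu(4)])
      thus ?thesis using lam mu by auto
    qed (use lam in auto)
  next
    case lam: (3 a b)
    show ?thesis
      using assms(2,4)
    proof (cases rule: partition_le2_cases)
      case mu: (3 c d)
      show ?thesis
      proof (cases "a = c")
        case False
        have ca: "c < a" using assms(6) lam mu False by auto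
        obtain P Q where X: "jordan_op n a b (mat_op n X) P Q"
          using nilpotent_class_jordan_op[OF XY(1), of a b n] lam by auto
        obtain P' Q' where Y: "jordan_op n c d (mat_op n Y) P' Q'"
          using nilpotent_class_jordan_op[OF XY(2), of c d n] mu by auto
        note two = commuting_two_blocks[OF X Y commuting_jordan_ops[OF X Y carrier XY(3)]
            lam(4) mu(4) ca]
        \<comment> \<open>Here m = c, and \<open>b = c - 1\<close> follows from the sum;
          \<open>0 < b\<close> makes this a true subtraction.\<close>
        have "n = 2 * c \<and> lam = [c + 1, c - 1] \<and> mu = [c, c]"
          using two(1,2) lam mu by auto
        with two(3) show ?thesis by blast
      qed (use lam mu in auto)
    \<comment> \<open>The case \<open>mu = [n]\<close> is excluded since its part exceeds
      \<open>a\<close>.\<close>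
    qed (use lam assms(6) in auto)
  qed
qed

end
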